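(* Let $Q$ be a convex polygon with $n$ edges and diameter $D$, and let $p$ be a point moving around $Q$, with the inflated-hierarchy kinetic data structure (described in the context) maintaining a separating edge between $p$ and $Q$. If $p$ moves along a path $\pi$ whose minimum distance to $Q$ is $\Omega(D/n)$, then the number of events is at most the size of the smallest $\kappa$-clear decomposition of $\pi$, where $\kappa=2\beta+1=5+4\sqrt2\approx 10.6569$ and $\beta=2(1+\sqrt2)$.
   Context: $\kappa$-clear decompositions. For real $\kappa>1$, a circle (disk) is $\kappa$-clear if its radius is at most $1/\kappa$ times the distance from its center to $Q$. A $\kappa$-clear decomposition of a path $\pi$ is a decomposition of $\pi$ into contiguous segments $\pi_1,\dots,\pi_k$ such that each $\pi_i$ is contained in a $\kappa$-clear disk; its size is the number $k$ of segments. Boomerang hierarchy. Let $Q$ be a convex polygon, possibly with added zero-length edges at vertices, each with a prescribed outer normal lying between the normals of its neighboring edges. Start with a bounding rectangle $Q_0$ of $Q$. The (at most four) regions between $Q$ and $Q_0$ are the level-0 boomerangs; a boomerang is bounded by a concave chain of edges of $Q$ and by two further segments meeting at its apex. Recursively, a level-$i$ boomerang is split by the line through some (possibly zero-length) edge of its concave chain, perpendicular to that edge's outer normal, into a triangle containing the apex and two smaller level-$(i+1)$ boomerangs, until all edges of $Q$ have been introduced. The $i$-th envelope $Q_i$ is the union of $Q$ and all level-$i$ boomerangs; it is a convex polygon containing $Q$. Compass hierarchy. The boomerang hierarchy obtained by adding to $Q$ $O(n)$ zero-length edges whose outer normals form a regular recursive lattice of compass directions on the unit circle (E, N, W, S;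 then NE, NW, SW, SE; etc.), where in the top $\lceil\log_2 n\rceil$ levels each boomerang is subdivided, using these directions in order, into two smaller boomerangs and an isosceles triangle, and in the remaining levels, if any, each boomerang is split by the line through the median edge of its chain. Inflated hierarchy. For a convex polygon $R$ and $\varepsilon>0$, the offset polygon $R[\varepsilon]$ is the convex polygon obtained by moving each edge of $R$ (including zero-length ones) outwards by $\varepsilon$, vertices moving along their angle bisectors. Let $Q_0,Q_1,\dots$ be the compass hierarchy of $Q$, let $\varepsilon_i=\alpha D/2^i$ be the approximation error of $Q_i$ (level-$i$ boomerangs of the compass hierarchy have height, i.e. distance from apex to concave chain, $O(D/2^i)$; $\alpha$ is the corresponding constant), and let $Q'_i=Q_i[\varepsilon_i]$. The data structure. As $p$ moves, it maintains a separating edge $e$ of some uninflated envelope $Q_i$, i.e. an edge whose supporting line $\overleftrightarrow{e}$ has $p$ on one side and $Q$ on the other. An event occurs when $p$ crosses $\overleftrightarrow{e}$. To compute the new separating edge, one finds the index $j$ such that $p$ lies outside $Q'_j$ but inside $Q'_{j-1}$, and takes the edge of $Q_j$ parallel to the edge of $Q'_j$ that intersects $\overleftrightarrow{e}$. *)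

theory Defs
  imports "HOL-Analysis.Analysis"
begin

text \<open>
  The Euclidean plane is the type \<^typ>\<open>complex\<close>, with \<^term>\<open>x \<bullet> y\<close> the standard
  inner product of the plane and \<^term>\<open>cis \<theta>\<close> the unit vector of direction \<open>\<theta>\<close>.
\<close>

section \<open>Convex polygons\<close>

definition convex_polygon :: "complex set \<Rightarrow> bool" where
  "convex_polygon Q \<longleftrightarrow> polytope Q \<and> aff_dim Q = 2"

definition num_edges :: "complex set \<Rightarrow> nat" where
  "num_edges Q = card {e. e edge_of Q}"

definition support_value :: "complex set \<Rightarrow> complex \<Rightarrow> real" where
  "support_value R u = (SUP x\<in>R. x \<bullet> u)"

text \<open>
  For a polygon \<open>R\<close> and a unit vector \<open>u\<close>, the line through the edge of \<open>R\<close> with outer normal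
  \<open>u\<close>, and that edge itself.  The edge may have length zero: if \<open>u\<close> lies strictly between the outer
  normals of two neighboring edges, \<open>support_line R u\<close> is the line perpendicular to \<open>u\<close> through
  their common vertex and \<open>edge_at R u\<close> consists of that vertex only.
\<close>

definition support_line :: "complex set \<Rightarrow> complex \<Rightarrow> complex set" where
  "support_line R u = {x. x \<bullet> u = support_value R u}"

definition edge_at :: "complex set \<Rightarrow> complex \<Rightarrow> complex set" where
  "edge_at R u = R \<inter> support_line R u"

text \<open>
  All angles of outer normals of (positive-length) edges; this set is closed under adding multiples
  of \<^term>\<open>2 * pi\<close>.
\<close>

definition edge_angles :: "complex set \<Rightarrow> real set" where
  "edge_angles Q = {\<theta>. edge_at Q (cis \<theta>) edge_of Q}"


section \<open>The boomerang hierarchy\<close>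

text \<open>
  A polygon with added zero-length edges is given by the polygon \<open>Q\<close> together with the
  \<open>2\<pi>\<close>-periodic set \<open>N\<close> of the angles of the outer normals of all its edges, zero-length ones
  included.  A boomerang is given by the angles \<open>a < b\<close> of the outer normals of the two segments
  meeting at its apex; the edges of its concave chain are those with outer normal angle in
  \<^term>\<open>N \<inter> {a<..<b}\<close>.
\<close>

definition apex :: "complex set \<Rightarrow> real \<Rightarrow> real \<Rightarrow> complex" where
  "apex Q a b = (THE x. x \<in> support_line Q (cis a) \<and> x \<in> support_line Q (cis b))"

text \<open>
  The chain runs counterclockwise from the counterclockwise end of the edge with normal \<^term>\<open>cis a\<close>
  to the clockwise end of the edge with normal \<^term>\<open>cis b\<close>.  These two ends are the extreme points
  of the two edges in the directions \<^term>\<open>cis (a + pi/2)\<close> and \<^term>\<open>cis (b - pi/2)\<close>.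
\<close>

definition concave_chain :: "complex set \<Rightarrow> real set \<Rightarrow> real \<Rightarrow> real \<Rightarrow> complex set" where
  "concave_chain Q N a b =
     edge_at (edge_at Q (cis a)) (cis (a + pi/2)) \<union>
     (\<Union>\<theta>\<in>N \<inter> {a<..<b}. edge_at Q (cis \<theta>)) \<union>
     edge_at (edge_at Q (cis b)) (cis (b - pi/2))"

text \<open>
  The hull below is the triangle spanned by the apex and the two ends of the chain.
\<close>

definition boomerang_region :: "complex set \<Rightarrow> real set \<Rightarrow> real \<Rightarrow> real \<Rightarrow> complex set" where
  "boomerang_region Q N a b =
     (convex hull (insert (apex Q a b) (concave_chain Q N a b)) - Q) \<union> concave_chain Q N a b"

definition boomerang_height :: "complex set \<Rightarrow> real set \<Rightarrow> real \<Rightarrow> real \<Rightarrow> real" where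
  "boomerang_height Q N a b = infdist (apex Q a b) (concave_chain Q N a b)"

text \<open>
  The level-\<open>i\<close> boomerangs.  The bounding rectangle has the outer normals E, N, W, S.
  A boomerang \<open>(a, b)\<close> on level \<open>i\<close> is split by the line of the edge of its chain whose normal has
  the angle \<open>pick i a b\<close>.  A boomerang all of whose edges have been introduced is a single vertex of
  \<open>Q\<close> and is kept as it is.
\<close>

fun boomerangs ::
  "(nat \<Rightarrow> real \<Rightarrow> real \<Rightarrow> real) \<Rightarrow> real set \<Rightarrow> nat \<Rightarrow> (real \<times> real) set" where
  "boomerangs pick N 0 = {(0, pi/2), (pi/2, pi), (pi, 3*pi/2), (3*pi/2, 2*pi)}"
| "boomerangs pick N (Suc i) =
     (\<Union>(a, b)\<in>boomerangs pick N i.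
        if N \<inter> {a<..<b} = {} then {(a, b)}
        else {(a, pick i a b), (pick i a b, b)})"


section \<open>The compass hierarchy\<close>

definition compass_levels :: "complex set \<Rightarrow> nat" where
  "compass_levels Q = nat \<lceil>log 2 (real (num_edges Q))\<rceil>"

text \<open>E, N, W, S for \<open>i = 0\<close>; each level adds the bisectors of neighboring directions.\<close>

definition compass_angles :: "nat \<Rightarrow> real set" where
  "compass_angles i = {of_int k * (pi/2) / 2^i | k. True}"

definition compass_edge_angles :: "complex set \<Rightarrow> real set" where
  "compass_edge_angles Q = edge_angles Q \<union> compass_angles (compass_levels Q)"

text \<open>
  In the top levels, splitting along the compass direction in the middle between the two sides
  meeting at the apex cuts off an isosceles triangle.  Afterwards the median edge is used (the upper
  median, if the number of edges of the chain is even).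
\<close>

definition compass_pick :: "complex set \<Rightarrow> nat \<Rightarrow> real \<Rightarrow> real \<Rightarrow> real" where
  "compass_pick Q i a b =
     (if i < compass_levels Q then (a + b) / 2
      else let xs = sorted_list_of_set (compass_edge_angles Q \<inter> {a<..<b})
           in xs ! (length xs div 2))"

definition compass_boomerangs :: "complex set \<Rightarrow> nat \<Rightarrow> (real \<times> real) set" where
  "compass_boomerangs Q i = boomerangs (compass_pick Q) (compass_edge_angles Q) i"

definition envelope :: "complex set \<Rightarrow> nat \<Rightarrow> complex set" where
  "envelope Q i =
     Q \<union> (\<Union>(a, b)\<in>compass_boomerangs Q i. boomerang_region Q (compass_edge_angles Q) a b)"

text \<open>Outer normals of the edges of the envelope, including its zero-length edges.\<close>

definition envelope_normals :: "complex set \<Rightarrow> nat \<Rightarrow> complex set" where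
  "envelope_normals Q i = (\<Union>(a, b)\<in>compass_boomerangs Q i. {cis a, cis b})"

text \<open>
  \<open>\<alpha>\<close> is a constant in the bound \<open>O(D/2^i)\<close> for the heights of the level-\<open>i\<close> boomerangs, uniform over
  all polygons.  The bound concerns the levels produced by compass directions: splitting at
  median edges does not decrease heights geometrically, so no uniform constant covers all levels.
\<close>

definition compass_height_constant :: "real \<Rightarrow> bool" where
  "compass_height_constant \<alpha> \<longleftrightarrow>
     (\<forall>Q i a b. convex_polygon Q \<and> i \<le> compass_levels Q \<and> (a, b) \<in> compass_boomerangs Q i \<longrightarrow>
        boomerang_height Q (compass_edge_angles Q) a b \<le> \<alpha> * diameter Q / 2^i)"


section \<open>The inflated hierarchy\<close>

text \<open>
  The offset polygon of the polygon \<open>R\<close> whose edges (including zero-length ones) have the outer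
  normals in \<open>U\<close>: the half-plane of every edge is moved outwards by \<open>\<epsilon>\<close>.  For \<open>\<epsilon> \<ge> 0\<close> all edges
  persist and vertices move along their angle bisectors.
\<close>

definition offset_polygon :: "complex set \<Rightarrow> complex set \<Rightarrow> real \<Rightarrow> complex set" where
  "offset_polygon R U \<epsilon> = {x. \<forall>u\<in>U. x \<bullet> u \<le> support_value R u + \<epsilon>}"

definition inflated_envelope :: "real \<Rightarrow> complex set \<Rightarrow> nat \<Rightarrow> complex set" where
  "inflated_envelope \<alpha> Q i =
     offset_polygon (envelope Q i) (envelope_normals Q i) (\<alpha> * diameter Q / 2^i)"


section \<open>The kinetic data structure\<close>

text \<open>
  An edge \<open>(i, u)\<close> is the edge of the \<open>i\<close>-th envelope with outer normal \<open>u\<close>.  It is separating for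
  the position \<open>x\<close> if its supporting line has \<open>Q\<close> on its inner side (which is automatic) and \<open>x\<close>
  on its outer side; both \<open>Q\<close> and \<open>x\<close> may touch the line.
\<close>

definition separating_edge :: "complex set \<Rightarrow> nat \<times> complex \<Rightarrow> complex \<Rightarrow> bool" where
  "separating_edge Q e x \<longleftrightarrow> (case e of (i, u) \<Rightarrow>
     u \<in> envelope_normals Q i \<and>
     (\<forall>q\<in>Q. q \<bullet> u \<le> support_value (envelope Q i) u) \<and>
     support_value (envelope Q i) u \<le> x \<bullet> u)"

text \<open>
  The point, moving along the path \<open>\<pi>\<close> during the time interval \<open>[0,1]\<close>, has \<open>e\<close> as a separating
  edge from time \<open>s\<close> on, until it crosses the line of \<open>e\<close> at time \<open>t\<close>: at time \<open>t\<close> it is on the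
  line, and arbitrarily shortly afterwards it is strictly on the inner side.
\<close>

definition crosses_at ::
  "complex set \<Rightarrow> (real \<Rightarrow> complex) \<Rightarrow> nat \<times> complex \<Rightarrow> real \<Rightarrow> real \<Rightarrow> bool" where
  "crosses_at Q \<pi> e s t \<longleftrightarrow> s \<le> t \<and> t \<le> 1 \<and>
     (\<forall>r\<in>{s..t}. separating_edge Q e (\<pi> r)) \<and>
     (case e of (i, u) \<Rightarrow>
        \<pi> t \<in> support_line (envelope Q i) u \<and>
        (\<exists>\<^sub>F r in at t within {t<..1}. \<pi> r \<bullet> u < support_value (envelope Q i) u))"

text \<open>
  The edge chosen when the point crosses the line of \<open>(i, u)\<close> at the position \<open>x\<close>.  For \<open>j = 0\<close>
  there is no inflated envelope that \<open>x\<close> has to lie in.  The line of \<open>(i, u)\<close> also intersects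
  the edge through which it leaves the \<open>j\<close>-th inflated envelope on the side averted from \<open>x\<close>; requiring
  the new edge to be separating excludes that one.  If the line enters through a vertex, both
  edges at that vertex are admitted.
\<close>

definition replacement_edge ::
  "real \<Rightarrow> complex set \<Rightarrow> nat \<times> complex \<Rightarrow> complex \<Rightarrow> nat \<times> complex \<Rightarrow> bool" where
  "replacement_edge \<alpha> Q e x e' \<longleftrightarrow> (case e of (i, u) \<Rightarrow> case e' of (j, v) \<Rightarrow>
     x \<notin> inflated_envelope \<alpha> Q j \<and>
     (j = 0 \<or> x \<in> inflated_envelope \<alpha> Q (j - 1)) \<and>
     v \<in> envelope_normals Q j \<and>
     edge_at (inflated_envelope \<alpha> Q j) v \<inter> support_line (envelope Q i) u \<noteq> {} \<and>
     separating_edge Q (j, v) x)"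

text \<open>
  \<open>kds_run \<alpha> Q \<pi> m t e\<close>: in some run of the data structure along \<open>\<pi>\<close>, started at time \<open>0\<close> with an
  arbitrary separating edge, the \<open>m\<close>-th event occurs at time \<open>t\<close> and makes \<open>e\<close> the maintained
  edge (for \<open>m = 0\<close>, \<open>e\<close> is the initial edge and \<open>t = 0\<close>).
\<close>

inductive kds_run ::
  "real \<Rightarrow> complex set \<Rightarrow> (real \<Rightarrow> complex) \<Rightarrow> nat \<Rightarrow> real \<Rightarrow> nat \<times> complex \<Rightarrow> bool"
  for \<alpha> Q \<pi> where
  start: "separating_edge Q e (\<pi> 0) \<Longrightarrow> kds_run \<alpha> Q \<pi> 0 0 e"
| event: "kds_run \<alpha> Q \<pi> m s e \<Longrightarrow> crosses_at Q \<pi> e s t \<Longrightarrow>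
          replacement_edge \<alpha> Q e (\<pi> t) e' \<Longrightarrow> kds_run \<alpha> Q \<pi> (Suc m) t e'"


section \<open>Clear decompositions\<close>

definition clear_disk :: "real \<Rightarrow> complex set \<Rightarrow> complex set \<Rightarrow> bool" where
  "clear_disk \<kappa> Q B \<longleftrightarrow> (\<exists>z r. B = cball z r \<and> 0 \<le> r \<and> r \<le> 1 / \<kappa> * infdist z Q)"

text \<open>The \<open>i\<close>-th segment of the path is its restriction to \<open>[\<tau> i, \<tau> (i + 1)]\<close>.\<close>

definition clear_decomposition ::
  "real \<Rightarrow> complex set \<Rightarrow> (real \<Rightarrow> complex) \<Rightarrow> nat \<Rightarrow> (nat \<Rightarrow> real) \<Rightarrow> bool" where
  "clear_decomposition \<kappa> Q \<pi> k \<tau> \<longleftrightarrow>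
     \<tau> 0 = 0 \<and> \<tau> k = 1 \<and>
     (\<forall>i<k. \<tau> i < \<tau> (Suc i) \<and>
        (\<exists>B. clear_disk \<kappa> Q B \<and> path_image (subpath (\<tau> i) (\<tau> (Suc i)) \<pi>) \<subseteq> B))"

definition min_clear_size :: "real \<Rightarrow> complex set \<Rightarrow> (real \<Rightarrow> complex) \<Rightarrow> nat" where
  "min_clear_size \<kappa> Q \<pi> = (LEAST k. \<exists>\<tau>. clear_decomposition \<kappa> Q \<pi> k \<tau>)"

end

theory Submission
  imports Defs
begin

text \<open>
  If an event at \<open>x\<close> selects the edge with normal \<open>v\<close> on level \<open>j\<close>, then \<open>x\<close> lies beyond the
  inflated edge, so its distance to the line of the new edge exceeds \<open>\<epsilon>\<^sub>j\<close>.  On the other hand \<open>x\<close>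
  lies in \<open>Q'\<^sub>j\<^sub>-\<^sub>1\<close>: writing the direction from \<open>Q\<close> to \<open>x\<close> as a positive combination of the two
  neighboring edge normals, which make an angle of at most \<open>\<pi>/2\<close>, bounds the distance of \<open>x\<close> from
  \<open>Q\<close> by \<open>(1 + \<surd>2) \<epsilon>\<^sub>j\<^sub>-\<^sub>1 = \<beta> \<epsilon>\<^sub>j\<close>.  So before the next event the point travels at least
  \<open>d(x, Q) / \<beta>\<close>, whereas the diameter of a \<open>\<kappa>\<close>-clear disk containing \<open>x\<close> is at most
  \<open>2 d(x, Q) / (\<kappa> - 1) = d(x, Q) / \<beta>\<close>.  Hence no such disk contains two events.

  For \<open>j = 0\<close> the point may be arbitrarily far away.  The old line touches \<open>Q\<close>, and the portion
  of it between \<open>Q\<close> and the inflated rectangle has length at most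
  \<open>\<surd>2 (D + \<epsilon>\<^sub>0) \<le> 3\<surd>2 \<epsilon>\<^sub>0 < \<beta> \<epsilon>\<^sub>0\<close>, because \<open>\<alpha> \<ge> 1/2\<close>; beyond the inflated edge the distance to
  the new line grows at least proportionally.
\<close>

section \<open>Trigonometry in the plane\<close>

lemma inner_cis: "x \<bullet> cis a = Re x * cos a + Im x * sin a"
  by (simp add: inner_complex_def)

text \<open>Cramer's rule for \<open>cis c\<close> in the basis \<open>cis a\<close>,
  \<open>cis b\<close>, multiplied through by the determinant \<open>sin (b - a)\<close>. For c
  between a and b with b - a \<le> \<pi> both coefficients are nonnegative, so upper bounds in the
  directions a and b carry over to c.\<close>

lemma sin_inner_cis:
  "sin (b - a) * (x \<bullet> cis c) = sin (b - c) * (x \<bullet> cis a) + sin (c - a) * (x \<bullet> cis b)"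
proof -
  have 1: "sin (b - a) * cos c = sin (b - c) * cos a + sin (c - a) * cos b"
    by (simp add: sin_diff algebra_simps)
  have 2: "sin (b - a) * sin c = sin (b - c) * sin a + sin (c - a) * sin b"
    by (simp add: sin_diff algebra_simps)
  have "sin (b - a) * (x \<bullet> cis c) = Re x * (sin (b - a) * cos c) + Im x * (sin (b - a) * sin c)"
    by (simp add: inner_cis algebra_simps)
  then show ?thesis
    unfolding 1 2 by (simp add: inner_cis algebra_simps)
qed

text \<open>Source of the factor \<surd>2. The sum-to-product formula bounds the left side by twice
  the sine of the half-sum; the half-sum is at most 45 degrees, so \<surd>2 times its cosine is at
  least 1 and completes the double-angle formula.\<close>

lemma sin_add_sin_le:
  assumes "0 \<le> s" "0 \<le> t" "s + t \<le> pi/2"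
  shows "sin s + sin t \<le> sqrt 2 * sin (s + t)"
proof -
  let ?m = "(s + t) / 2" and ?d = "(s - t) / 2"
  have sum: "sin s + sin t = 2 * sin ?m * cos ?d" by (rule sin_plus_sin)
  have m: "sin ?m \<ge> 0" using assms by (intro sin_ge_zero) auto
  have "sqrt 2 / 2 \<le> cos ?m"
    using assms by (subst cos_45[symmetric], intro cos_monotone_0_pi_le) auto
  then have "sqrt 2 * (sqrt 2 / 2) \<le> sqrt 2 * cos ?m" by (intro mult_left_mono) auto
  then have c: "1 \<le> sqrt 2 * cos ?m" by simp
  have "2 * sin ?m * cos ?d \<le> 2 * sin ?m * (sqrt 2 * cos ?m)"
    using m c cos_le_one[of ?d] by (intro mult_left_mono) linarith+
  also have "\<dots> = sqrt 2 * sin (2 * ?m)" unfolding sin_double by simp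
  also have "2 * ?m = s + t" by simp
  finally show ?thesis unfolding sum .
qed

section \<open>Support values, chains and apexes\<close>

lemma inner_le_support_value:
  assumes "bounded Q" "x \<in> Q"
  shows "x \<bullet> u \<le> support_value Q u"
proof -
  have "bdd_above ((\<lambda>x. x \<bullet> u) ` Q)"
    by (intro bounded_imp_bdd_above bounded_linear_image[OF assms(1)] bounded_linear_inner_left)
  then show ?thesis unfolding support_value_def by (rule cSUP_upper[OF assms(2)])
qed

lemma support_value_attained:
  assumes "compact Q" "Q \<noteq> {}"
  obtains q where "q \<in> Q" "q \<bullet> u = support_value Q u"
proof -
  have "continuous_on Q (\<lambda>x. x \<bullet> u)" by (intro continuous_intros)
  from continuous_attains_sup[OF assms this] obtain q where
    q: "q \<in> Q" "\<And>y. y \<in> Q \<Longrightarrow> y \<bullet> u \<le> q \<bullet> u" by blast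
  have "support_value Q u \<le> q \<bullet> u"
    unfolding support_value_def using assms q by (intro cSUP_least) auto
  with inner_le_support_value[OF compact_imp_bounded[OF assms(1)] q(1), of u]
  have "q \<bullet> u = support_value Q u" by simp
  with q(1) show thesis by (rule that)
qed

lemma edge_at_subset: "edge_at R u \<subseteq> R"
  by (auto simp: edge_at_def)

lemma edge_at_nonempty:
  assumes "compact R" "R \<noteq> {}"
  shows "edge_at R u \<noteq> {}"
  using support_value_attained[OF assms, of u] by (auto simp: edge_at_def support_line_def)

lemma compact_edge_at:
  assumes "compact R"
  shows "compact (edge_at R u)"
proof -
  have "support_line R u = {x. u \<bullet> x = support_value R u}"
    by (simp add: support_line_def inner_commute)
  then show ?thesis
    unfolding edge_at_def using assms by (simp add: compact_Int_closed closed_hyperplane)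
qed

lemma concave_chain_subset: "concave_chain Q N a b \<subseteq> Q"
  unfolding concave_chain_def using edge_at_subset by blast

lemma concave_chain_nonempty:
  assumes "compact Q" "Q \<noteq> {}"
  shows "concave_chain Q N a b \<noteq> {}"
  using assms by (simp add: concave_chain_def edge_at_nonempty compact_edge_at)

text \<open>\<open>apex\<close> is a definite description, so existence and uniqueness must be
  shown. Both rest on the linear independence of the two normals: a vector orthogonal to both is
  orthogonal to every direction.\<close>

lemma apex_inner:
  assumes "sin (b - a) \<noteq> 0"
  shows "apex Q a b \<bullet> cis a = support_value Q (cis a)"
    and "apex Q a b \<bullet> cis b = support_value Q (cis b)"
proof -
  define h k where "h = support_value Q (cis a)" and "k = support_value Q (cis b)"
  \<comment> \<open>Solution by Cramer's rule of the two linear equations for the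
    coordinates.\<close>
  define A where "A = Complex ((h * sin b - k * sin a) / sin (b - a))
                              ((k * cos a - h * cos b) / sin (b - a))"
  let ?P = "\<lambda>x. x \<in> support_line Q (cis a) \<and> x \<in> support_line Q (cis b)"
  have A: "?P A"
  proof -
    have "A \<bullet> cis a = h * (sin b * cos a - cos b * sin a) / sin (b - a)"
      unfolding inner_cis A_def by (simp add: add_divide_distrib[symmetric] algebra_simps)
    then have "A \<bullet> cis a = h" using assms by (simp add: sin_diff)
    have "A \<bullet> cis b = k * (sin b * cos a - cos b * sin a) / sin (b - a)"
      unfolding inner_cis A_def by (simp add: add_divide_distrib[symmetric] algebra_simps)
    then have "A \<bullet> cis b = k" using assms by (simp add: sin_diff)
    with \<open>A \<bullet> cis a = h\<close> show ?thesis by (simp add: support_line_def h_def k_def)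
  qed
  have "x = A" if "?P x" for x
  proof -
    have "(x - A) \<bullet> cis a = 0" "(x - A) \<bullet> cis b = 0"
      using that A by (simp_all add: support_line_def inner_diff_left)
    then have "(x - A) \<bullet> cis c = 0" for c
      using sin_inner_cis[where ?b = b and ?a = a and ?x = "x - A" and ?c = c] assms by simp
    from this[of 0] this[of "pi/2"] show ?thesis by (simp add: inner_cis complex_eq_iff)
  qed
  then have "apex Q a b = A" unfolding apex_def using A by (intro the_equality) blast+
  with A show "apex Q a b \<bullet> cis a = support_value Q (cis a)"
    "apex Q a b \<bullet> cis b = support_value Q (cis b)" by (simp_all add: support_line_def)
qed

text \<open>Slide from the apex along one of its two sides to a point \<open>q\<close> where that
  side touches \<open>Q\<close>. In the expansion of the direction c, one term of
  \<open>?A - q\<close> vanishes and the other has a known sign, so the value in direction c does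
  not drop on the way to \<open>q\<close>.\<close>

lemma apex_le_support_value:
  assumes Q: "compact Q" "Q \<noteq> {}" and pos: "sin (b - a) > 0"
    and c: "sin (c - b) \<ge> 0 \<or> sin (c - a) \<le> 0"
  shows "apex Q a b \<bullet> cis c \<le> support_value Q (cis c)"
proof -
  let ?A = "apex Q a b"
  have A: "?A \<bullet> cis a = support_value Q (cis a)" "?A \<bullet> cis b = support_value Q (cis b)"
    using apex_inner[of b a Q] pos by auto
  have le: "q \<bullet> u \<le> support_value Q u" if "q \<in> Q" for q u
    using inner_le_support_value[OF compact_imp_bounded[OF Q(1)] that] .
  have "\<exists>q\<in>Q. sin (b - a) * ((?A - q) \<bullet> cis c) \<le> 0"
    using c
  proof
    assume s: "sin (c - b) \<ge> 0"
    obtain q where q: "q \<in> Q" "q \<bullet> cis b = support_value Q (cis b)"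
      using support_value_attained[OF Q] .
    have "(?A - q) \<bullet> cis b = 0" "(?A - q) \<bullet> cis a \<ge> 0"
      using A q le[OF q(1)] by (simp_all add: inner_diff_left)
    moreover have "sin (b - c) \<le> 0" using s sin_minus[of "c - b"] by simp
    ultimately show ?thesis
      using q(1) by (intro bexI[of _ q], subst sin_inner_cis) (simp_all add: mult_nonpos_nonneg)
  next
    assume s: "sin (c - a) \<le> 0"
    obtain q where q: "q \<in> Q" "q \<bullet> cis a = support_value Q (cis a)"
      using support_value_attained[OF Q] .
    have "(?A - q) \<bullet> cis a = 0" "(?A - q) \<bullet> cis b \<ge> 0"
      using A q le[OF q(1)] by (simp_all add: inner_diff_left)
    then show ?thesis
      using q(1) s by (intro bexI[of _ q], subst sin_inner_cis) (simp_all add: mult_nonpos_nonneg)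
  qed
  then obtain q where "q \<in> Q" "(?A - q) \<bullet> cis c \<le> 0"
    using pos by (auto simp: mult_le_0_iff)
  with le[of q "cis c"] show ?thesis by (simp add: inner_diff_left)
qed

section \<open>The boomerang hierarchy as a subdivision of angle intervals\<close>

declare boomerangs.simps(2) [simp del]

text \<open>Abstracts from the compass rule what the combinatorics of the hierarchy needs. The
  demand is limited to intervals within one turn, the only ones that occur.\<close>

definition inner_pick :: "(nat \<Rightarrow> real \<Rightarrow> real \<Rightarrow> real) \<Rightarrow> real set \<Rightarrow> bool" where
  "inner_pick pick N \<longleftrightarrow> (\<forall>i a b. 0 \<le> a \<and> a < b \<and> b \<le> 2*pi \<and> N \<inter> {a<..<b} \<noteq> {} \<longrightarrow>
     a < pick i a b \<and> pick i a b < b)"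

lemma boomerangs_0_cases:
  assumes "(a, b) \<in> boomerangs pick N 0"
  obtains "a = 0" "b = pi/2" | "a = pi/2" "b = pi" | "a = pi" "b = 3*pi/2" | "a = 3*pi/2" "b = 2*pi"
  using assms by auto

text \<open>Splitting only shrinks intervals, and the initial ones are quarter turns. The bound
  \<pi>/2 later makes \<open>sin (b - a)\<close> positive and admits
  \<open>sin_add_sin_le\<close>.\<close>

lemma boomerangs_bounds:
  assumes "inner_pick pick N" "(a, b) \<in> boomerangs pick N i"
  shows "0 \<le> a \<and> a < b \<and> b \<le> 2*pi \<and> b - a \<le> pi/2"
  using assms(2)
proof (induction i arbitrary: a b)
  case 0
  have "0 < pi" by (rule pi_gt_zero)
  with 0 show ?case by (elim boomerangs_0_cases; intro conjI; linarith)
next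
  case (Suc i)
  obtain c d where cd: "(c, d) \<in> boomerangs pick N i"
    and ab: "(a, b) \<in> (if N \<inter> {c<..<d} = {} then {(c, d)} else {(c, pick i c d), (pick i c d, d)})"
    using Suc.prems by (auto simp: boomerangs.simps)
  have bd: "0 \<le> c \<and> c < d \<and> d \<le> 2*pi \<and> d - c \<le> pi/2" using Suc.IH[OF cd] .
  then have "N \<inter> {c<..<d} \<noteq> {} \<longrightarrow> c < pick i c d \<and> pick i c d < d"
    using assms(1) unfolding inner_pick_def by blast
  then show ?case using ab bd by (cases "N \<inter> {c<..<d} = {}") auto
qed

lemma boomerangs_SucE:
  assumes "inner_pick pick N" "(a, b) \<in> boomerangs pick N (Suc i)"
  obtains c d where "(c, d) \<in> boomerangs pick N i"
    "if N \<inter> {c<..<d} = {} then a = c \<and> b = d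
     else c < pick i c d \<and> pick i c d < d \<and>
       (a = c \<and> b = pick i c d \<or> a = pick i c d \<and> b = d)"
proof -
  obtain c d where cd: "(c, d) \<in> boomerangs pick N i"
    and ab: "(a, b) \<in> (if N \<inter> {c<..<d} = {} then {(c, d)} else {(c, pick i c d), (pick i c d, d)})"
    using assms(2) by (auto simp: boomerangs.simps)
  have bd: "0 \<le> c \<and> c < d \<and> d \<le> 2*pi" using boomerangs_bounds[OF assms(1) cd] by blast
  show thesis
  proof (cases "N \<inter> {c<..<d} = {}")
    case True
    then show ?thesis using ab that[OF cd] by auto
  next
    case False
    then have "c < pick i c d \<and> pick i c d < d"
      using assms(1) bd unfolding inner_pick_def by blast
    then show ?thesis using ab that[OF cd] False by auto
  qed
qed

text \<open>Two children of one parent meet only in the splitting angle; children of different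
  parents inherit the separation of their parents.\<close>

lemma boomerangs_disjoint:
  assumes "inner_pick pick N" "(a, b) \<in> boomerangs pick N i" "(c, d) \<in> boomerangs pick N i"
  shows "a = c \<and> b = d \<or> b \<le> c \<or> d \<le> a"
  using assms(2,3)
proof (induction i arbitrary: a b c d)
  case 0
  have "0 < pi" by (rule pi_gt_zero)
  with 0 show ?case by (elim boomerangs_0_cases; linarith)
next
  case (Suc i)
  obtain a' b' where ab: "(a', b') \<in> boomerangs pick N i"
    "if N \<inter> {a'<..<b'} = {} then a = a' \<and> b = b'
     else a' < pick i a' b' \<and> pick i a' b' < b' \<and>
       (a = a' \<and> b = pick i a' b' \<or> a = pick i a' b' \<and> b = b')"
    using boomerangs_SucE[OF assms(1) Suc.prems(1)] .
  obtain c' d' where cd: "(c', d') \<in> boomerangs pick N i"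
    "if N \<inter> {c'<..<d'} = {} then c = c' \<and> d = d'
     else c' < pick i c' d' \<and> pick i c' d' < d' \<and>
       (c = c' \<and> d = pick i c' d' \<or> c = pick i c' d' \<and> d = d')"
    using boomerangs_SucE[OF assms(1) Suc.prems(2)] .
  from Suc.IH[OF ab(1) cd(1)] consider "a' = c'" "b' = d'" | "b' \<le> c' \<or> d' \<le> a'" by blast
  then show ?case
  proof cases
    case 1
    with ab(2) cd(2) show ?thesis by (cases "N \<inter> {a'<..<b'} = {}") auto
  next
    case 2
    moreover have "a' \<le> a \<and> b \<le> b'" using ab(2) by (auto split: if_splits)
    moreover have "c' \<le> c \<and> d \<le> d'" using cd(2) by (auto split: if_splits)
    ultimately show ?thesis by linarith
  qed
qed

lemma boomerangs_SucI:
  assumes "(a, b) \<in> boomerangs pick N i"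
  shows "N \<inter> {a<..<b} = {} \<Longrightarrow> (a, b) \<in> boomerangs pick N (Suc i)"
    and "N \<inter> {a<..<b} \<noteq> {} \<Longrightarrow> (a, pick i a b) \<in> boomerangs pick N (Suc i)"
    and "N \<inter> {a<..<b} \<noteq> {} \<Longrightarrow> (pick i a b, b) \<in> boomerangs pick N (Suc i)"
  using assms by (auto intro!: bexI[of _ "(a, b)"] simp: boomerangs.simps disjoint_iff split: if_splits)

text \<open>Supplies, on any level, two neighboring edge normals enclosing a given
  direction.\<close>

lemma boomerangs_cover:
  assumes "0 \<le> t" "t \<le> 2*pi"
  obtains a b where "(a, b) \<in> boomerangs pick N i" "a \<le> t" "t \<le> b"
proof -
  have "\<exists>(a, b)\<in>boomerangs pick N i. a \<le> t \<and> t \<le> b"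
  proof (induction i)
    case 0
    show ?case using assms by auto
  next
    case (Suc i)
    then obtain a b where ab: "(a, b) \<in> boomerangs pick N i" "a \<le> t" "t \<le> b" by blast
    show ?case
    proof (cases "N \<inter> {a<..<b} = {}")
      case True
      then show ?thesis using ab boomerangs_SucI(1)[OF ab(1)] by blast
    next
      case False
      note split = boomerangs_SucI(2,3)[OF ab(1) False]
      show ?thesis using split ab linear[of t "pick i a b"] by blast
    qed
  qed
  then show thesis using that by blast
qed

definition endpoints :: "('a \<times> 'a) set \<Rightarrow> 'a set" where
  "endpoints S = fst ` S \<union> snd ` S"

text \<open>An edge once introduced stays: both outer angles survive a split, and an unsplit
  boomerang is kept. Hence the normals of the envelopes increase with the level.\<close>

lemma endpoints_boomerangs_Suc:
  "endpoints (boomerangs pick N i) \<subseteq> endpoints (boomerangs pick N (Suc i))"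
proof -
  have *: "a \<in> endpoints S" "b \<in> endpoints S" if "(a, b) \<in> S" for a b and S :: "(real \<times> real) set"
    using that by (force simp: endpoints_def)+
  have "a \<in> endpoints (boomerangs pick N (Suc i))" "b \<in> endpoints (boomerangs pick N (Suc i))"
    if "(a, b) \<in> boomerangs pick N i" for a b
    using boomerangs_SucI[OF that] * by blast+
  then show ?thesis by (subst endpoints_def) auto
qed

lemma endpoints_boomerangs_mono:
  "i \<le> j \<Longrightarrow> endpoints (boomerangs pick N i) \<subseteq> endpoints (boomerangs pick N j)"
  by (rule lift_Suc_mono_le[of "\<lambda>i. endpoints (boomerangs pick N i)"])
    (rule endpoints_boomerangs_Suc)

lemma envelope_normals_eq: "envelope_normals Q i = cis ` endpoints (compass_boomerangs Q i)"
  by (force simp: envelope_normals_def endpoints_def)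

lemma envelope_normals_mono: "i \<le> j \<Longrightarrow> envelope_normals Q i \<subseteq> envelope_normals Q j"
  unfolding envelope_normals_eq compass_boomerangs_def
  by (intro image_mono endpoints_boomerangs_mono)

section \<open>Size of polygons, finiteness of their normals, and the compass rule\<close>

lemma convex_polygonD:
  assumes "convex_polygon Q"
  shows "compact Q" "convex Q" "Q \<noteq> {}"
  using assms aff_dim_empty[of Q]
  by (auto simp: convex_polygon_def polytope_imp_compact polytope_imp_convex)

lemma two_points_of_aff_dim:
  assumes "aff_dim S > 0"
  obtains x y where "x \<in> S" "y \<in> S" "x \<noteq> y"
proof -
  have "\<not> S \<subseteq> {a}" for a
    using aff_dim_subset[of S "{a}"] assms by auto
  moreover have "S \<noteq> {}" using assms aff_dim_empty[of S] by auto
  ultimately show thesis using that by blast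
qed

lemma diameter_pos:
  assumes "convex_polygon Q"
  shows "diameter Q > 0"
proof -
  obtain x y where "x \<in> Q" "y \<in> Q" "x \<noteq> y"
    using two_points_of_aff_dim[of Q] assms by (auto simp: convex_polygon_def)
  then have "dist x y \<le> diameter Q" "dist x y > 0"
    using diameter_bounded_bound compact_imp_bounded convex_polygonD(1)[OF assms] by auto
  then show ?thesis by linarith
qed

lemma num_edges_pos:
  assumes "convex_polygon Q"
  shows "num_edges Q > 0"
proof -
  have Q: "polytope Q" "aff_dim Q = 2" using assms by (auto simp: convex_polygon_def)
  then obtain F where "F facet_of Q" using polytope_facet_exists[of Q] by auto
  then have "F edge_of Q" using Q by (simp add: facet_of_def edge_of_def)
  \<comment> \<open>Finiteness matters, as \<open>card\<close> of an infinite set is 0.\<close>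
  moreover have "finite {e. e edge_of Q}"
    using finite_polytope_faces[OF Q(1)] by (rule finite_subset[rotated]) (auto simp: edge_of_def)
  ultimately show ?thesis by (auto simp: num_edges_def card_gt_0_iff)
qed

text \<open>Links the clearance \<Omega>(D/n) to the levels: at the last compass level the offset is
  at most \<alpha>D/n.\<close>

lemma num_edges_le_compass_levels:
  assumes "convex_polygon Q"
  shows "real (num_edges Q) \<le> 2 ^ compass_levels Q"
proof -
  let ?n = "real (num_edges Q)"
  have n: "?n > 0" using num_edges_pos[OF assms] by simp
  have "log 2 ?n \<le> real (compass_levels Q)" unfolding compass_levels_def
    by (rule real_nat_ceiling_ge)
  then have "?n \<le> 2 powr real (compass_levels Q)" using n by (simp add: log_le_iff)
  then show ?thesis by (simp add: powr_realpow)
qed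

lemma Arg2pi_cis: "0 \<le> t \<Longrightarrow> t < 2*pi \<Longrightarrow> Arg2pi (cis t) = t"
  by (rule Arg2pi_unique[of 1]) (auto simp: cis_conv_exp)

text \<open>In the plane, the orthogonal complement of a unit vector \<open>u\<close> is the line
  spanned by its quarter turn \<open>\<i> * u\<close>.\<close>

lemma orthogonal_complexE:
  fixes w u :: complex
  assumes "w \<bullet> u = 0" "norm u = 1"
  obtains k :: real where "w = k *\<^sub>R (\<i> * u)" "\<bar>k\<bar> = norm w"
proof -
  \<comment> \<open>This is the imaginary part of \<open>w * cnj u\<close>, the coordinate of
    \<open>w\<close> along \<open>\<i> * u\<close>.\<close>
  define k where "k = Im w * Re u - Re w * Im u"
  have wu: "Im w * Im u = - (Re w * Re u)" using assms(1) by (simp add: inner_complex_def)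
  have n: "Re u * Re u + Im u * Im u = 1"
    using assms(2) by (simp add: cmod_def power2_eq_square)
  have "k * Im u = (Im w * Im u) * Re u - Re w * (Im u * Im u)"
    by (simp add: k_def algebra_simps)
  also have "\<dots> = - (Re w * (Re u * Re u + Im u * Im u))"
    unfolding wu by (simp add: algebra_simps)
  finally have R: "k * Im u = - Re w" unfolding n by simp
  have "k * Re u = Im w * (Re u * Re u) - (Re w * Re u) * Im u"
    by (simp add: k_def algebra_simps)
  also have "\<dots> = Im w * (Re u * Re u) + (Im w * Im u) * Im u"
    unfolding wu by simp
  also have "\<dots> = Im w * (Re u * Re u + Im u * Im u)" by (simp add: algebra_simps)
  finally have I: "k * Re u = Im w" unfolding n by simp
  have w: "w = k *\<^sub>R (\<i> * u)" using R I by (simp add: complex_eq_iff)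
  then have "norm w = \<bar>k\<bar>" using assms(2) by (simp add: norm_mult)
  then show thesis using that[OF w] by simp
qed

lemma finite_unit_orthogonal:
  fixes w :: complex
  assumes "w \<noteq> 0"
  shows "finite {u. norm u = 1 \<and> w \<bullet> u = 0}"
proof (rule finite_subset)
  show "{u. norm u = 1 \<and> w \<bullet> u = 0} \<subseteq> (\<lambda>k. - \<i> * w / of_real k) ` {norm w, - norm w}"
  proof clarify
    fix u assume "norm u = 1" "w \<bullet> u = 0"
    then obtain k where k: "w = k *\<^sub>R (\<i> * u)" "\<bar>k\<bar> = norm w"
      using orthogonal_complexE by blast
    have "k \<noteq> 0" using k assms by auto
    then have "u = - \<i> * w / of_real k"
      by (subst k(1)) (simp add: scaleR_conv_of_real field_simps)
    moreover have "k \<in> {norm w, - norm w}" using k(2) by auto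
    ultimately show "u \<in> (\<lambda>k. - \<i> * w / of_real k) ` {norm w, - norm w}" by blast
  qed
qed simp

text \<open>Two distinct points of an edge determine its unit normal up to sign, and there are
  finitely many edges. Restricting to one open turn removes the periodic copies and makes
  \<open>cis\<close> injective.\<close>

lemma finite_edge_angles:
  assumes "convex_polygon Q"
  shows "finite (edge_angles Q \<inter> {0<..<2*pi})"
proof -
  have fin: "finite {e. e edge_of Q}"
    using finite_polytope_faces[of Q] assms
    by (rule_tac finite_subset[rotated]) (auto simp: edge_of_def convex_polygon_def)
  have inj: "inj_on cis {0<..<2*pi}"
    by (rule inj_on_inverseI[of _ Arg2pi]) (auto simp: Arg2pi_cis)
  have "finite {u. norm u = 1 \<and> edge_at Q u = e}" if "e edge_of Q" for e
  proof -
    have "aff_dim e > 0" using that by (simp add: edge_of_def)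
    then obtain p q where pq: "p \<in> e" "q \<in> e" "p \<noteq> q" by (rule two_points_of_aff_dim)
    have "(p - q) \<bullet> u = 0" if "edge_at Q u = e" for u
      using pq that by (auto simp: edge_at_def support_line_def inner_diff_left)
    then have "{u. norm u = 1 \<and> edge_at Q u = e} \<subseteq> {u. norm u = 1 \<and> (p - q) \<bullet> u = 0}" by blast
    moreover have "finite {u. norm u = 1 \<and> (p - q) \<bullet> u = 0}"
      using pq by (intro finite_unit_orthogonal) simp
    ultimately show ?thesis by (rule finite_subset)
  qed
  then have "finite (\<Union>e\<in>{e. e edge_of Q}. {u. norm u = 1 \<and> edge_at Q u = e})"
    using fin by blast
  then have "finite (cis ` (edge_angles Q \<inter> {0<..<2*pi}))"
    by (rule finite_subset[rotated]) (auto simp: edge_angles_def)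
  then show ?thesis by (rule finite_imageD) (rule inj_on_subset[OF inj], blast)
qed

lemma finite_compass_angles: "finite (compass_angles i \<inter> {a<..<b})"
proof -
  let ?d = "(pi/2) / 2^i :: real"
  have d: "?d > 0" by simp
  have "compass_angles i \<inter> {a<..<b} \<subseteq> (\<lambda>k. of_int k * (pi/2) / 2^i) ` {\<lfloor>a / ?d\<rfloor> .. \<lceil>b / ?d\<rceil>}"
  proof
    fix x assume "x \<in> compass_angles i \<inter> {a<..<b}"
    then obtain k where k: "x = of_int k * (pi/2) / 2^i" "a < x" "x < b"
      by (auto simp: compass_angles_def)
    have "x = of_int k * ?d" using k(1) by simp
    then have "a / ?d < of_int k" "of_int k < b / ?d"
      using k(2,3) d by (simp_all only: pos_divide_less_eq pos_less_divide_eq)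
    then have "k \<in> {\<lfloor>a / ?d\<rfloor> .. \<lceil>b / ?d\<rceil>}" by (simp del: divide_divide_eq_right divide_divide_eq_left) linarith
    with k(1) show "x \<in> (\<lambda>k. of_int k * (pi/2) / 2^i) ` {\<lfloor>a / ?d\<rfloor> .. \<lceil>b / ?d\<rceil>}" by blast
  qed
  then show ?thesis by (rule finite_subset) simp
qed

text \<open>A bisector is clearly interior. For the median, the set of angles must be finite, since
  \<open>sorted_list_of_set\<close> of an infinite set is empty; then the chosen entry is a member
  of the set.\<close>

lemma inner_compass_pick:
  assumes "convex_polygon Q"
  shows "inner_pick (compass_pick Q) (compass_edge_angles Q)"
  unfolding inner_pick_def
proof (intro allI impI)
  fix i a b
  assume ab: "0 \<le> a \<and> a < b \<and> b \<le> 2*pi \<and> compass_edge_angles Q \<inter> {a<..<b} \<noteq> {}"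
  show "a < compass_pick Q i a b \<and> compass_pick Q i a b < b"
  proof (cases "i < compass_levels Q")
    case True
    then show ?thesis using ab by (simp add: compass_pick_def)
  next
    case False
    let ?S = "compass_edge_angles Q \<inter> {a<..<b}"
    let ?xs = "sorted_list_of_set ?S"
    have "?S \<subseteq> (edge_angles Q \<inter> {0<..<2*pi}) \<union>
        (compass_angles (compass_levels Q) \<inter> {a<..<b})"
      using ab by (auto simp: compass_edge_angles_def)
    then have fin: "finite ?S"
      by (rule finite_subset) (simp add: finite_edge_angles[OF assms] finite_compass_angles)
    then have "?xs \<noteq> []" using ab by simp
    then have "?xs ! (length ?xs div 2) \<in> set ?xs"
      by (intro nth_mem div_less_dividend) (simp_all del: length_sorted_list_of_set)
    then have "?xs ! (length ?xs div 2) \<in> ?S" using fin by simp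
    then show ?thesis using False by (simp add: compass_pick_def Let_def)
  qed
qed

lemma compass_boomerangs_bounds:
  assumes "convex_polygon Q" "(a, b) \<in> compass_boomerangs Q i"
  shows "0 \<le> a" "a < b" "b \<le> 2*pi" "b - a \<le> pi/2" "sin (b - a) > 0"
proof -
  show *: "0 \<le> a" "a < b" "b \<le> 2*pi" "b - a \<le> pi/2"
    using boomerangs_bounds[OF inner_compass_pick[OF assms(1)]] assms(2)
    unfolding compass_boomerangs_def by blast+
  show "sin (b - a) > 0" using * by (intro sin_gt_zero) (auto intro: le_less_trans)
qed

section \<open>Support values of envelopes and inflated envelopes\<close>

lemma compass_apex_le_support_value:
  assumes Q: "convex_polygon Q" and ab: "(a, b) \<in> compass_boomerangs Q i"
    and u: "u \<in> envelope_normals Q i"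
  shows "apex Q a b \<bullet> u \<le> support_value Q u"
proof -
  obtain c d where cd: "(c, d) \<in> compass_boomerangs Q i" "u = cis c \<or> u = cis d"
    using u by (auto simp: envelope_normals_def)
  note B = compass_boomerangs_bounds[OF Q ab] compass_boomerangs_bounds[OF Q cd(1)]
  have "a = c \<and> b = d \<or> b \<le> c \<or> d \<le> a"
    using boomerangs_disjoint[OF inner_compass_pick[OF Q]] ab cd(1)
    unfolding compass_boomerangs_def by blast
  then obtain t where t: "u = cis t" "0 \<le> t" "t \<le> 2*pi" "t \<le> a \<or> b \<le> t"
    using cd(2) B by auto
  \<comment> \<open>Since boomerangs of one level do not overlap, the angle of \<open>u\<close>
    lies, up to a full turn, on the arc from b to a + 2\<pi> complementary to the boomerang.\<close>
  have "\<exists>s. u = cis s \<and> b \<le> s \<and> s \<le> a + 2*pi"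
  proof (cases "t \<le> a")
    case True
    then show ?thesis
      using t B by (intro exI[of _ "t + 2*pi"]) (simp add: complex_eq_iff)
  next
    case False
    then show ?thesis using t B by (intro exI[of _ t]) auto
  qed
  then obtain s where s: "u = cis s" "b \<le> s" "s \<le> a + 2*pi" by blast
  \<comment> \<open>On the first half turn of this arc the first alternative holds; the remainder
    lies in the last half turn before a + 2\<pi>, where the second holds.\<close>
  have "sin (s - b) \<ge> 0 \<or> sin (s - a) \<le> 0"
  proof (cases "s \<le> b + pi")
    case True
    then show ?thesis using s by (intro disjI1 sin_ge_zero) auto
  next
    case False
    then have "sin (s - a - pi) \<ge> 0" using s B by (intro sin_ge_zero) auto
    moreover have "sin (s - a - pi) = - sin (s - a)" by simp
    ultimately show ?thesis by linarith
  qed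
  then show ?thesis
    unfolding s(1) using convex_polygonD[OF Q] B by (intro apex_le_support_value)
qed

text \<open>An envelope adds to \<open>Q\<close> only parts of hulls of apexes and points of
  \<open>Q\<close>, and none of the apexes lies beyond the line. So the lines of envelope edges are
  supporting lines of \<open>Q\<close> itself, and everything below is computed with
  \<open>Q\<close> alone.\<close>

lemma support_value_envelope:
  assumes Q: "convex_polygon Q" and u: "u \<in> envelope_normals Q i"
  shows "support_value (envelope Q i) u = support_value Q u"
proof -
  note c = convex_polygonD[OF Q]
  let ?H = "{x. u \<bullet> x \<le> support_value Q u}"
  have QH: "Q \<subseteq> ?H"
    using inner_le_support_value[OF compact_imp_bounded[OF c(1)]] by (auto simp: inner_commute)
  have "boomerang_region Q (compass_edge_angles Q) a b \<subseteq> ?H"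
    if ab: "(a, b) \<in> compass_boomerangs Q i" for a b
  proof -
    have C: "concave_chain Q (compass_edge_angles Q) a b \<subseteq> ?H"
      using QH concave_chain_subset by blast
    moreover have "apex Q a b \<in> ?H"
      using compass_apex_le_support_value[OF Q ab u] by (simp add: inner_commute)
    ultimately have "convex hull (insert (apex Q a b) (concave_chain Q (compass_edge_angles Q) a b)) \<subseteq> ?H"
      by (intro hull_minimal convex_halfspace_le) auto
    with C show ?thesis unfolding boomerang_region_def by blast
  qed
  then have E: "envelope Q i \<subseteq> ?H" unfolding envelope_def using QH by blast
  have sub: "Q \<subseteq> envelope Q i" by (auto simp: envelope_def)
  have "support_value (envelope Q i) u \<le> support_value Q u"
    unfolding support_value_def[of "envelope Q i"] using E sub c(3)
    by (intro cSUP_least) (auto simp: inner_commute)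
  moreover have "support_value Q u \<le> support_value (envelope Q i) u"
    unfolding support_value_def
  proof (rule cSUP_subset_mono[OF c(3) _ sub])
    show "bdd_above ((\<lambda>x. x \<bullet> u) ` envelope Q i)"
      using E by (intro bdd_aboveI[of _ "support_value Q u"]) (auto simp: inner_commute)
  qed simp
  ultimately show ?thesis by simp
qed

lemma inflated_envelope_iff:
  assumes "convex_polygon Q"
  shows "x \<in> inflated_envelope \<alpha> Q i \<longleftrightarrow>
    (\<forall>u\<in>envelope_normals Q i. x \<bullet> u \<le> support_value Q u + \<alpha> * diameter Q / 2^i)"
  using support_value_envelope[OF assms]
  by (auto simp: inflated_envelope_def offset_polygon_def)

lemma norm_envelope_normals: "u \<in> envelope_normals Q i \<Longrightarrow> norm u = 1"
  by (auto simp: envelope_normals_eq)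

lemma convex_inflated_envelope: "convex (inflated_envelope \<alpha> Q i)"
proof -
  have "inflated_envelope \<alpha> Q i = (\<Inter>u\<in>envelope_normals Q i.
      {x. u \<bullet> x \<le> support_value (envelope Q i) u + \<alpha> * diameter Q / 2^i})"
    by (auto simp: inflated_envelope_def offset_polygon_def inner_commute)
  then show ?thesis by (simp add: convex_INT convex_halfspace_le)
qed

lemma subset_inflated_envelope:
  assumes "convex_polygon Q" "0 \<le> \<alpha>"
  shows "Q \<subseteq> inflated_envelope \<alpha> Q i"
proof
  fix q assume q: "q \<in> Q"
  have "0 \<le> \<alpha> * diameter Q / 2^i" using assms diameter_pos[OF assms(1)] by simp
  then show "q \<in> inflated_envelope \<alpha> Q i"
    using inner_le_support_value[OF compact_imp_bounded[OF convex_polygonD(1)[OF assms(1)]] q]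
    by (auto simp: inflated_envelope_iff[OF assms(1)] intro: add_increasing2)
qed

text \<open>A deeper level imposes more half-planes, each with a smaller offset.\<close>

lemma inflated_envelope_antimono:
  assumes Q: "convex_polygon Q" and "0 \<le> \<alpha>" "i \<le> j"
  shows "inflated_envelope \<alpha> Q j \<subseteq> inflated_envelope \<alpha> Q i"
proof -
  have "\<alpha> * diameter Q / 2^j \<le> \<alpha> * diameter Q / 2^i"
    using assms diameter_pos[OF Q] by (intro divide_left_mono) (auto simp: power_increasing)
  then show ?thesis
    using envelope_normals_mono[OF \<open>i \<le> j\<close>, of Q] by (fastforce simp: inflated_envelope_iff[OF Q])
qed

text \<open>Offsetting makes no half-plane redundant, so points of an inflated edge lie exactly at
  the offset distance from the original line.\<close>

lemma support_value_inflated_envelope: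
  assumes Q: "convex_polygon Q" and "0 \<le> \<alpha>" and v: "v \<in> envelope_normals Q j"
  shows "support_value (inflated_envelope \<alpha> Q j) v = support_value Q v + \<alpha> * diameter Q / 2^j"
proof -
  let ?e = "\<alpha> * diameter Q / 2^j" and ?I = "inflated_envelope \<alpha> Q j"
  have e: "0 \<le> ?e" using assms diameter_pos[OF Q] by simp
  note c = convex_polygonD[OF Q]
  obtain p where p: "p \<in> Q" "p \<bullet> v = support_value Q v"
    using support_value_attained[OF c(1,3)] .
  \<comment> \<open>Witness: a point of \<open>Q\<close> touching the line of \<open>v\<close>,
    pushed out by the offset. It advances in any other unit direction \<open>u\<close> by at most
    the offset too.\<close>
  have I: "p + ?e *\<^sub>R v \<in> ?I"
    unfolding inflated_envelope_iff[OF Q]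
  proof
    fix u assume u: "u \<in> envelope_normals Q j"
    have "v \<bullet> u \<le> 1"
      using norm_cauchy_schwarz[of v u] norm_envelope_normals[OF u] norm_envelope_normals[OF v] by simp
    then have "?e * (v \<bullet> u) \<le> ?e" using e by (rule mult_left_le)
    moreover have "p \<bullet> u \<le> support_value Q u"
      using inner_le_support_value[OF compact_imp_bounded[OF c(1)] p(1)] .
    ultimately show "(p + ?e *\<^sub>R v) \<bullet> u \<le> support_value Q u + ?e"
      by (simp add: inner_add_left)
  qed
  have "v \<bullet> v = 1" using norm_envelope_normals[OF v] by (simp add: norm_eq_1)
  then have val: "(p + ?e *\<^sub>R v) \<bullet> v = support_value Q v + ?e"
    using p(2) by (simp add: inner_add_left)
  have le: "x \<bullet> v \<le> support_value Q v + ?e" if "x \<in> ?I" for x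
    using that v inflated_envelope_iff[OF Q] by blast
  show ?thesis
    unfolding support_value_def[of ?I]
    by (intro cSup_eq_maximum) (use I val le in force)+
qed

section \<open>Consequences of the height constant\<close>

lemma infdist_greatest:
  "A \<noteq> {} \<Longrightarrow> (\<And>a. a \<in> A \<Longrightarrow> d \<le> dist x a) \<Longrightarrow> d \<le> infdist x A"
  unfolding infdist_notempty by (rule cINF_greatest)

text \<open>Let \<open>q\<close> be the point of \<open>Q\<close> closest to \<open>x\<close>, and
  measure along the direction \<theta> from \<open>q\<close> to \<open>x\<close>. The apex
  \<open>?A\<close> of the boomerang containing \<theta> splits the distance: from \<open>?A\<close>
  to \<open>x\<close> it is at most \<surd>2 offsets by the two neighboring half-planes, and from
  \<open>q\<close> to \<open>?A\<close> at most the boomerang height, which \<alpha> bounds on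
  compass levels.\<close>

lemma infdist_inflated_envelope_le:
  assumes \<alpha>: "compass_height_constant \<alpha>" "0 \<le> \<alpha>" and Q: "convex_polygon Q"
    and i: "i \<le> compass_levels Q" and x: "x \<in> inflated_envelope \<alpha> Q i"
  shows "infdist x Q \<le> (1 + sqrt 2) * (\<alpha> * diameter Q / 2^i)"
proof (cases "x \<in> Q")
  case True
  then show ?thesis using \<alpha>(2) diameter_pos[OF Q] by simp
next
  case False
  let ?e = "\<alpha> * diameter Q / 2^i"
  have e: "0 \<le> ?e" using \<alpha>(2) diameter_pos[OF Q] by simp
  note c = convex_polygonD[OF Q]
  define q where "q = closest_point Q x"
  have q: "q \<in> Q" unfolding q_def using c by (intro closest_point_in_set) (auto simp: compact_imp_closed)
  define \<theta> where "\<theta> = Arg2pi (x - q)"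
  have \<theta>: "0 \<le> \<theta>" "\<theta> < 2*pi" "x - q = norm (x - q) *\<^sub>R cis \<theta>"
    unfolding \<theta>_def using Arg2pi_ge_0 Arg2pi_lt_2pi Arg2pi_eq[of "x - q"]
    by (simp_all add: cis_conv_exp scaleR_conv_of_real)
  obtain a b where ab: "(a, b) \<in> compass_boomerangs Q i" "a \<le> \<theta>" "\<theta> \<le> b"
    using boomerangs_cover[of \<theta>] \<theta> unfolding compass_boomerangs_def by (metis less_imp_le)
  note B = compass_boomerangs_bounds[OF Q ab(1)]
  let ?A = "apex Q a b" and ?C = "concave_chain Q (compass_edge_angles Q) a b"
  have U: "cis a \<in> envelope_normals Q i" "cis b \<in> envelope_normals Q i"
    using ab(1) by (auto simp: envelope_normals_def)
  have "(x - ?A) \<bullet> cis a \<le> ?e" "(x - ?A) \<bullet> cis b \<le> ?e"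
    using x U apex_inner[of b a Q] B(5) by (force simp: inflated_envelope_iff[OF Q] inner_diff_left)+
  moreover have s: "0 \<le> sin (b - \<theta>)" "0 \<le> sin (\<theta> - a)"
    using ab B pi_gt_zero by (auto intro!: sin_ge_zero)
  ultimately have "sin (b - a) * ((x - ?A) \<bullet> cis \<theta>) \<le> sin (b - \<theta>) * ?e + sin (\<theta> - a) * ?e"
    by (subst sin_inner_cis) (intro add_mono mult_left_mono)
  also have "\<dots> = (sin (b - \<theta>) + sin (\<theta> - a)) * ?e" by (simp only: distrib_right)
  also have "\<dots> \<le> (sqrt 2 * sin ((b - \<theta>) + (\<theta> - a))) * ?e"
    using ab B e by (intro mult_right_mono sin_add_sin_le) auto
  also have "\<dots> = sin (b - a) * (sqrt 2 * ?e)" by simp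
  finally have 1: "(x - ?A) \<bullet> cis \<theta> \<le> sqrt 2 * ?e"
    using B(5) by (simp only: mult_le_cancel_left_pos)
  \<comment> \<open>As \<open>q\<close> is closest to \<open>x\<close>, all of \<open>Q\<close>, and
    so the chain, lies behind the line through \<open>q\<close> perpendicular to \<theta>; reaching
    the chain from \<open>?A\<close> requires at least the descent to that line.\<close>
  have "(?A - q) \<bullet> cis \<theta> \<le> infdist ?A ?C"
  proof (rule infdist_greatest)
    show "?C \<noteq> {}" using concave_chain_nonempty[OF c(1,3)] .
    fix z assume "z \<in> ?C"
    then have "z \<in> Q" using concave_chain_subset by blast
    have "(x - q) \<bullet> (z - q) \<le> 0"
      unfolding q_def using c \<open>z \<in> Q\<close> by (intro closest_point_dot) (auto simp: compact_imp_closed)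
    then have "(norm (x - q) *\<^sub>R cis \<theta>) \<bullet> (z - q) \<le> 0" using \<theta>(3) by simp
    then have "(z - q) \<bullet> cis \<theta> \<le> 0"
      using False q by (auto simp: mult_le_0_iff inner_commute)
    then have "(?A - q) \<bullet> cis \<theta> \<le> (?A - z) \<bullet> cis \<theta>" by (simp add: inner_diff_left)
    also have "\<dots> \<le> norm (?A - z) * norm (cis \<theta>)" by (rule norm_cauchy_schwarz)
    finally show "(?A - q) \<bullet> cis \<theta> \<le> dist ?A z" by (simp add: dist_norm)
  qed
  also have "\<dots> \<le> ?e"
    using \<alpha>(1) Q i ab(1) unfolding compass_height_constant_def boomerang_height_def by blast
  finally have 2: "(?A - q) \<bullet> cis \<theta> \<le> ?e" .
  have "infdist x Q \<le> norm (x - q)" using infdist_le[OF q] by (simp add: dist_norm)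
  also have "\<dots> = (x - q) \<bullet> cis \<theta>"
  proof -
    have "cis \<theta> \<bullet> cis \<theta> = 1" by (simp add: dot_square_norm)
    then have "(norm (x - q) *\<^sub>R cis \<theta>) \<bullet> cis \<theta> = norm (x - q)" by simp
    then show ?thesis using \<theta>(3) by simp
  qed
  also have "\<dots> = (x - ?A) \<bullet> cis \<theta> + (?A - q) \<bullet> cis \<theta>" by (simp add: inner_diff_left)
  also have "\<dots> \<le> sqrt 2 * ?e + ?e" using 1 2 by (rule add_mono)
  also have "\<dots> = (1 + sqrt 2) * ?e" by (simp only: distrib_right mult_1 add.commute)
  finally show ?thesis .
qed

text \<open>
  The bound is attained at the corner of the bounding square opposite to the hypotenuse of a right
  isosceles triangle.
\<close>

lemma half_le_compass_height_constant:
  assumes "compass_height_constant \<alpha>"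
  shows "1/2 \<le> \<alpha>"
proof -
  define Q where "Q = convex hull {0, 1, \<i>}"
  have ind: "\<not> affine_dependent {0, 1, \<i>}"
  proof -
    have "independent {1, \<i>}"
      by (rule pairwise_orthogonal_independent)
        (auto simp: pairwise_def orthogonal_def inner_complex_def)
    then show ?thesis by (subst affine_dependent_iff_dependent) auto
  qed
  have "aff_dim {0, 1, \<i>} = 2" using aff_dim_affine_independent[OF ind] by simp
  then have "aff_dim Q = 2" by (simp add: Q_def aff_dim_convex_hull)
  then have Q: "convex_polygon Q"
    unfolding convex_polygon_def Q_def by (simp add: polytope_convex_hull)
  note c = convex_polygonD[OF Q]
  \<comment> \<open>The triangle as an intersection of half-planes; \<open>1 + \<i>\<close> is
    normal to the hypotenuse.\<close>
  let ?H = "{z. (-1) \<bullet> z \<le> (0::real)} \<inter> {z. (-\<i>) \<bullet> z \<le> 0} \<inter> {z. (1 + \<i>) \<bullet> z \<le> 1}"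
  have "Q \<subseteq> ?H" unfolding Q_def
    by (rule hull_minimal, simp add: inner_complex_def)
      (intro convex_Int convex_halfspace_le)
  then have QH: "0 \<le> Re z \<and> 0 \<le> Im z \<and> Re z + Im z \<le> 1" if "z \<in> Q" for z
    using that by (auto simp: inner_complex_def)
  have "dist y z \<le> sqrt 2" if "y \<in> Q" "z \<in> Q" for y z
  proof -
    have "\<bar>Re y - Re z\<bar> \<le> 1" "\<bar>Im y - Im z\<bar> \<le> 1" using QH[OF that(1)] QH[OF that(2)] by linarith+
    then have "(Re y - Re z)^2 \<le> 1" "(Im y - Im z)^2 \<le> 1" by (simp_all add: abs_square_le_1)
    then show ?thesis by (simp add: dist_norm cmod_def)
  qed
  then have D: "diameter Q \<le> sqrt 2" using c(3) by (intro diameter_le) (auto simp: dist_norm)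
  have v: "0 \<in> Q" "1 \<in> Q" "\<i> \<in> Q" by (simp_all add: Q_def hull_inc)
  have h: "support_value Q (cis 0) = 1" "support_value Q (cis (pi/2)) = 1"
    unfolding support_value_def
    by (rule cSup_eq_maximum; use v QH in \<open>force simp: inner_complex_def\<close>)+
  let ?A = "apex Q 0 (pi/2)" and ?C = "concave_chain Q (compass_edge_angles Q) 0 (pi/2)"
  have A: "Re ?A = 1" "Im ?A = 1"
    using apex_inner[of "pi/2" 0 Q] h by (simp_all add: inner_complex_def)
  have "1 / sqrt 2 \<le> infdist ?A ?C"
  proof (rule infdist_greatest)
    show "?C \<noteq> {}" using concave_chain_nonempty[OF c(1,3)] .
    fix z assume "z \<in> ?C"
    then have "Re z + Im z \<le> 1" using concave_chain_subset QH by blast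
    then have "1 \<le> (?A - z) \<bullet> (1 + \<i>)" using A by (simp add: inner_complex_def)
    also have "\<dots> \<le> norm (?A - z) * norm (1 + \<i>)" by (rule norm_cauchy_schwarz)
    also have "norm (1 + \<i>) = sqrt 2" by (simp add: cmod_def)
    finally show "1 / sqrt 2 \<le> dist ?A z" by (simp add: dist_norm divide_le_eq)
  qed
  also have "infdist ?A ?C \<le> \<alpha> * diameter Q"
  proof -
    have "(0, pi/2) \<in> compass_boomerangs Q 0" by (simp add: compass_boomerangs_def)
    then have "infdist ?A ?C \<le> \<alpha> * diameter Q / 2^0"
      using assms Q unfolding compass_height_constant_def boomerang_height_def by blast
    then show ?thesis by simp
  qed
  finally have 1: "1 / sqrt 2 \<le> \<alpha> * diameter Q" .
  \<comment> \<open>The sign of \<alpha> is not given, but must be known before the upper bound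
    \<surd>2 for the diameter can be inserted.\<close>
  have "0 < \<alpha> * diameter Q" by (rule less_le_trans[OF _ 1]) simp
  then have "0 < \<alpha>" using diameter_pos[OF Q] by (simp add: zero_less_mult_iff)
  then have "1 / sqrt 2 \<le> \<alpha> * sqrt 2" using D 1 by (meson mult_left_mono less_imp_le order_trans)
  then show ?thesis by (simp add: field_simps)
qed


section \<open>The gap between the point and its new separating line\<close>

text \<open>
  The line of the old edge touches \<open>Q\<close> in a point \<open>q\<close>.  Seen from \<open>q\<close>, the new position \<open>x\<close> lies
  beyond the point \<open>y\<close> where the line meets the inflated edge.
\<close>

lemma replacement_edge_line:
  assumes Q: "convex_polygon Q" and \<alpha>: "0 < \<alpha>"
    and u: "u \<in> envelope_normals Q i" and x: "x \<in> support_line (envelope Q i) u"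
    and rep: "replacement_edge \<alpha> Q (i, u) x (j, v)"
  obtains q y r where "q \<in> Q" "y \<in> inflated_envelope \<alpha> Q j" "1 < r" "x = q + r *\<^sub>R (y - q)"
    "r * (\<alpha> * diameter Q / 2^j) \<le> x \<bullet> v - support_value Q v"
proof -
  let ?e = "\<alpha> * diameter Q / 2^j" and ?I = "inflated_envelope \<alpha> Q j"
  have e: "0 < ?e" using \<alpha> diameter_pos[OF Q] by simp
  note c = convex_polygonD[OF Q]
  have v: "v \<in> envelope_normals Q j" and xI: "x \<notin> ?I"
    using rep by (auto simp: replacement_edge_def)
  have xv: "support_value Q v \<le> x \<bullet> v"
    using rep support_value_envelope[OF Q v] by (auto simp: replacement_edge_def separating_edge_def)
  obtain y where y: "y \<in> edge_at ?I v" "y \<in> support_line (envelope Q i) u"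
    using rep by (auto simp: replacement_edge_def)
  have yv: "y \<bullet> v = support_value Q v + ?e" and yI: "y \<in> ?I"
    using y(1) support_value_inflated_envelope[OF Q _ v, of \<alpha>] \<alpha>
    by (auto simp: edge_at_def support_line_def)
  obtain q where q: "q \<in> Q" "q \<bullet> u = support_value Q u"
    using support_value_attained[OF c(1,3)] .
  have qv: "q \<bullet> v \<le> support_value Q v"
    using inner_le_support_value[OF compact_imp_bounded[OF c(1)] q(1)] .
  have "(x - q) \<bullet> u = 0" "(y - q) \<bullet> u = 0"
    using x y(2) q(2) support_value_envelope[OF Q u]
    by (simp_all add: support_line_def inner_diff_left)
  moreover note norm_envelope_normals[OF u]
  \<comment> \<open>The points \<open>q\<close>, \<open>x\<close> and \<open>y\<close> all lie on
    the old line.\<close>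
  ultimately obtain k l :: real where kl: "x - q = k *\<^sub>R (\<i> * u)" "y - q = l *\<^sub>R (\<i> * u)"
    by (metis orthogonal_complexE)
  have "y \<noteq> q" using yv qv e by auto
  then have "l \<noteq> 0" using kl by auto
  define r where "r = k / l"
  have "x - q = r *\<^sub>R (y - q)" using kl \<open>l \<noteq> 0\<close> by (simp add: r_def)
  then have xq: "x = q + r *\<^sub>R (y - q)" by (simp add: algebra_simps)
  define g where "g = support_value Q v - q \<bullet> v"
  have g: "0 \<le> g" using qv by (simp add: g_def)
  \<comment> \<open>The signed distance to the new line is affine in \<open>r\<close>: it is
    \<open>- g\<close> at \<open>q\<close> (r = 0) and the offset \<open>?e\<close> at
    \<open>y\<close> (r = 1).\<close>
  have f: "x \<bullet> v - support_value Q v = r * (?e + g) - g"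
    unfolding xq g_def by (simp add: inner_add_left inner_diff_left yv)
  then have "0 \<le> r * (?e + g)" using xv g by linarith
  then have "0 \<le> r" using e g by (simp add: zero_le_mult_iff)
  \<comment> \<open>Otherwise \<open>x\<close> would be on the segment from \<open>q\<close> to
    \<open>y\<close>, inside the convex inflated envelope.\<close>
  have "1 < r"
  proof (rule ccontr)
    assume "\<not> 1 < r"
    then have "(1 - r) *\<^sub>R q + r *\<^sub>R y \<in> ?I"
      using \<open>0 \<le> r\<close> yI q(1) subset_inflated_envelope[OF Q, of \<alpha> j] \<alpha>
      by (intro convexD[OF convex_inflated_envelope]) auto
    moreover have "(1 - r) *\<^sub>R q + r *\<^sub>R y = x" unfolding xq by (simp add: algebra_simps)
    ultimately show False using xI by simp
  qed
  then have "1 * g \<le> r * g" using g by (intro mult_right_mono) auto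
  then have "r * ?e \<le> x \<bullet> v - support_value Q v" unfolding f by (simp add: algebra_simps)
  then show thesis using that q(1) yI \<open>1 < r\<close> xq by blast
qed

text \<open>In each of the four axis directions, \<open>Q\<close> extends at most its diameter
  beyond \<open>q\<close>, and the inflated side at most the offset further. This bounds both
  coordinates of \<open>y - q\<close>.\<close>

lemma dist_inflated_rectangle_le:
  assumes Q: "convex_polygon Q" and q: "q \<in> Q" and y: "y \<in> inflated_envelope \<alpha> Q 0"
  shows "dist y q \<le> sqrt 2 * (diameter Q + \<alpha> * diameter Q)"
proof -
  let ?d = "diameter Q + \<alpha> * diameter Q"
  note c = convex_polygonD[OF Q]
  have le: "(y - q) \<bullet> u \<le> ?d" if u: "u \<in> envelope_normals Q 0" for u
  proof -
    obtain p where p: "p \<in> Q" "p \<bullet> u = support_value Q u"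
      using support_value_attained[OF c(1,3)] .
    have "(p - q) \<bullet> u \<le> norm (p - q) * norm u" by (rule norm_cauchy_schwarz)
    also have "\<dots> \<le> diameter Q"
      using diameter_bounded_bound[OF compact_imp_bounded[OF c(1)] p(1) q] norm_envelope_normals[OF u]
      by (simp add: dist_norm)
    finally have "(p - q) \<bullet> u \<le> diameter Q" .
    moreover have "y \<bullet> u \<le> support_value Q u + \<alpha> * diameter Q / 2^0"
      using y u inflated_envelope_iff[OF Q] by blast
    ultimately show ?thesis using p(2) by (simp add: inner_diff_left)
  qed
  have "(0, pi/2) \<in> compass_boomerangs Q 0" "(pi, 3*pi/2) \<in> compass_boomerangs Q 0"
    by (simp_all add: compass_boomerangs_def)
  then have "cis 0 \<in> envelope_normals Q 0" "cis (pi/2) \<in> envelope_normals Q 0"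
    "cis pi \<in> envelope_normals Q 0" "cis (3*pi/2) \<in> envelope_normals Q 0"
    unfolding envelope_normals_def by blast+
  moreover have "cis (3*pi/2) = - \<i>"
    using cis_mult[of pi "pi/2"] by simp
  ultimately have "1 \<in> envelope_normals Q 0" "\<i> \<in> envelope_normals Q 0"
    "-1 \<in> envelope_normals Q 0" "-\<i> \<in> envelope_normals Q 0" by simp_all
  from this[THEN le] have "\<bar>Re (y - q)\<bar> \<le> ?d" "\<bar>Im (y - q)\<bar> \<le> ?d"
    by (simp_all add: inner_complex_def abs_le_iff)
  then have d: "0 \<le> ?d" "(Re (y - q))^2 \<le> ?d^2" "(Im (y - q))^2 \<le> ?d^2"
    by (simp_all add: abs_le_square_iff[symmetric])
  then have "(norm (y - q))^2 \<le> 2 * ?d^2" unfolding cmod_power2 by linarith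
  also have "\<dots> = (sqrt 2 * ?d)^2" by (simp add: power_mult_distrib)
  finally show ?thesis using d(1) by (simp add: dist_norm power2_le_iff_abs_le)
qed

text \<open>Makes precise that the point must travel more than d(x, Q)/\<beta> to reach the new
  line. The assumption \<open>far\<close> keeps the selected level within the range where \<alpha>
  controls the heights.\<close>

lemma replacement_edge_gap:
  assumes \<alpha>: "compass_height_constant \<alpha>" and Q: "convex_polygon Q"
    and \<beta>: "\<beta> = 2 * (1 + sqrt 2)"
    and u: "u \<in> envelope_normals Q i" and x: "x \<in> support_line (envelope Q i) u"
    and rep: "replacement_edge \<alpha> Q (i, u) x (j, v)"
    and far: "(1 + sqrt 2) * (\<alpha> * diameter Q / real (num_edges Q)) < infdist x Q"
  shows "infdist x Q < \<beta> * (x \<bullet> v - support_value Q v)"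
proof -
  have half: "1/2 \<le> \<alpha>" using half_le_compass_height_constant[OF \<alpha>] .
  then have \<alpha>0: "0 < \<alpha>" by simp
  note D = diameter_pos[OF Q]
  have \<beta>0: "0 < \<beta>" unfolding \<beta> by (simp add: add_pos_pos)
  let ?e = "\<alpha> * diameter Q / 2^j"
  have e: "0 < ?e" using \<alpha>0 D by simp
  obtain q y r where q: "q \<in> Q" and y: "y \<in> inflated_envelope \<alpha> Q j" and r: "1 < r"
    and xq: "x = q + r *\<^sub>R (y - q)" and f: "r * ?e \<le> x \<bullet> v - support_value Q v"
    using replacement_edge_line[OF Q \<alpha>0 u x rep] .
  have "infdist x Q < \<beta> * (r * ?e)"
  proof (cases j)
    case 0
    have "infdist x Q \<le> dist x q" using q by (rule infdist_le)
    also have "\<dots> = r * dist y q" unfolding xq using r by (simp add: dist_norm)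
    also have "\<dots> \<le> r * (sqrt 2 * (diameter Q + \<alpha> * diameter Q))"
      using r y q 0 by (intro mult_left_mono dist_inflated_rectangle_le[OF Q]) auto
    \<comment> \<open>From \<alpha> \<ge> 1/2 the diameter is at most twice
      \<open>\<alpha> * diameter Q\<close>.\<close>
    also have "\<dots> \<le> r * (sqrt 2 * (3 * (\<alpha> * diameter Q)))"
      using r half D by (intro mult_left_mono) auto
    also have "\<dots> < r * (\<beta> * (\<alpha> * diameter Q))"
    proof -
      have "3 * sqrt 2 < \<beta>" using sqrt2_less_2 unfolding \<beta> by simp
      then have "3 * sqrt 2 * (\<alpha> * diameter Q) < \<beta> * (\<alpha> * diameter Q)"
        using \<alpha>0 D by (intro mult_strict_right_mono) auto
      then show ?thesis using r by simp
    qed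
    finally show ?thesis using 0 by (simp add: mult.left_commute)
  next
    case (Suc j')
    have xI: "x \<in> inflated_envelope \<alpha> Q j'"
      using rep Suc by (simp add: replacement_edge_def)
    \<comment> \<open>Otherwise \<open>x\<close> would lie in the inflated envelope of the last
      compass level, hence too close to \<open>Q\<close> for \<open>far\<close>.\<close>
    have "j' \<le> compass_levels Q"
    proof (rule ccontr)
      assume "\<not> j' \<le> compass_levels Q"
      then have "x \<in> inflated_envelope \<alpha> Q (compass_levels Q)"
        using xI inflated_envelope_antimono[OF Q, of \<alpha> "compass_levels Q" j'] \<alpha>0 by auto
      then have "infdist x Q \<le> (1 + sqrt 2) * (\<alpha> * diameter Q / 2 ^ compass_levels Q)"
        using infdist_inflated_envelope_le[OF \<alpha> _ Q] \<alpha>0 by simp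
      also have "\<dots> \<le> (1 + sqrt 2) * (\<alpha> * diameter Q / real (num_edges Q))"
        using num_edges_le_compass_levels[OF Q] num_edges_pos[OF Q] \<alpha>0 D
        by (intro mult_left_mono divide_left_mono) auto
      finally show False using far by simp
    qed
    then have "infdist x Q \<le> (1 + sqrt 2) * (\<alpha> * diameter Q / 2 ^ j')"
      using infdist_inflated_envelope_le[OF \<alpha> _ Q _ xI] \<alpha>0 by simp
    \<comment> \<open>The offset one level up is twice as large; this is the factor 2 in
      \<beta>.\<close>
    also have "\<dots> = \<beta> * (1 * ?e)" by (simp add: \<beta> Suc field_simps)
    also have "\<dots> < \<beta> * (r * ?e)" using \<beta>0 r e by (intro mult_strict_left_mono mult_strict_right_mono)
    finally show ?thesis .
  qed
  also have "\<dots> \<le> \<beta> * (x \<bullet> v - support_value Q v)" using f \<beta>0 by (intro mult_left_mono) auto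
  finally show ?thesis .
qed

section \<open>Counting events against clear decompositions\<close>

lemma clear_disk_dist_le:
  assumes "clear_disk (2 * \<beta> + 1) Q B" "0 < \<beta>" "x \<in> B" "y \<in> B"
  shows "\<beta> * dist x y \<le> infdist x Q"
proof -
  obtain z r where B: "B = cball z r" "r \<le> 1 / (2 * \<beta> + 1) * infdist z Q"
    using assms(1) by (auto simp: clear_disk_def)
  \<comment> \<open>Moving from the center to \<open>x\<close> costs at most \<open>r\<close> of the
    clearance, leaving \<beta> times the diameter 2r of the disk: hence \<kappa> = 2\<beta> +
    1.\<close>
  have "(2 * \<beta> + 1) * r \<le> infdist z Q" using B(2) assms(2) by (simp add: field_simps)
  moreover have "infdist z Q \<le> infdist x Q + dist z x" by (rule infdist_triangle)
  moreover have "dist z x \<le> r" "dist z y \<le> r" using assms(3,4) B(1) by auto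
  ultimately have "\<beta> * (2 * r) \<le> infdist x Q" by (simp add: algebra_simps)
  moreover have "dist x y \<le> 2 * r"
    using dist_triangle2[of x y z] \<open>dist z x \<le> r\<close> \<open>dist z y \<le> r\<close> by (simp add: dist_commute)
  then have "\<beta> * dist x y \<le> \<beta> * (2 * r)" using assms(2) by (intro mult_left_mono) auto
  ultimately show ?thesis by linarith
qed

text \<open>Two consecutive events in one segment would share a clear disk, yet the travel between
  them exceeds what the disk allows.\<close>

lemma kds_run_le_clear_decomposition:
  assumes \<alpha>: "compass_height_constant \<alpha>" and Q: "convex_polygon Q"
    and \<beta>: "\<beta> = 2 * (1 + sqrt 2)"
    and far: "\<And>t. 0 \<le> t \<Longrightarrow> t \<le> 1 \<Longrightarrow>
      (1 + sqrt 2) * (\<alpha> * diameter Q / real (num_edges Q)) < infdist (\<pi> t) Q"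
    and dec: "clear_decomposition (2 * \<beta> + 1) Q \<pi> k \<tau>"
    and run: "kds_run \<alpha> Q \<pi> m t e"
  shows "m \<le> k"
proof -
  have \<beta>0: "0 < \<beta>" unfolding \<beta> by (simp add: add_pos_pos)
  have \<tau>: "\<tau> 0 = 0" "\<tau> k = 1" using dec by (auto simp: clear_decomposition_def)
  \<comment> \<open>Invariant of the run. The gap clause is restricted to 0 < m because the initial
    edge is arbitrary and may have no gap. The last clause says that up to the end of segment i at
    most i + 1 events occur.\<close>
  have "0 \<le> t \<and> t \<le> 1 \<and>
    (0 < m \<longrightarrow> (case e of (j, v) \<Rightarrow> infdist (\<pi> t) Q < \<beta> * (\<pi> t \<bullet> v - support_value Q v))) \<and>
    (\<forall>i<k. t \<le> \<tau> (Suc i) \<longrightarrow> m \<le> Suc i)"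
    using run
  proof induction
    case (start e)
    show ?case by simp
  next
    case (event m s e t e')
    obtain i u where e: "e = (i, u)" by (cases e)
    obtain j v where e': "e' = (j, v)" by (cases e')
    have st: "0 \<le> s" "s \<le> t" "t \<le> 1" using event by (auto simp: crosses_at_def)
    have u: "u \<in> envelope_normals Q i"
      using event.hyps(2) unfolding crosses_at_def separating_edge_def e by force
    have line: "\<pi> t \<in> support_line (envelope Q i) u"
      using event.hyps(2) by (simp add: crosses_at_def e)
    have gap: "infdist (\<pi> t) Q < \<beta> * (\<pi> t \<bullet> v - support_value Q v)"
      using replacement_edge_gap[OF \<alpha> Q \<beta> u line] event.hyps(3) far[of t] st by (simp add: e e')
    have "Suc m \<le> Suc n" if n: "n < k" "t \<le> \<tau> (Suc n)" for n
    proof (rule ccontr)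
      assume "\<not> Suc m \<le> Suc n"
      then have mn: "n < m" by simp
      \<comment> \<open>If event m preceded segment n, the induction hypothesis for segment n - 1
        would give m \<le> n. So both events fall into segment n.\<close>
      have "\<tau> n \<le> s"
      proof (cases n)
        case 0
        then show ?thesis using \<tau> st by simp
      next
        case (Suc n')
        show ?thesis
        proof (rule ccontr)
          assume "\<not> \<tau> n \<le> s"
          then have "m \<le> Suc n'" using event.IH n Suc by auto
          then show False using mn Suc by simp
        qed
      qed
      then have "s \<in> {\<tau> n..\<tau> (Suc n)}" "t \<in> {\<tau> n..\<tau> (Suc n)}" using st n by auto
      moreover obtain B where B: "clear_disk (2 * \<beta> + 1) Q B" "\<tau> n < \<tau> (Suc n)"
        "path_image (subpath (\<tau> n) (\<tau> (Suc n)) \<pi>) \<subseteq> B"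
        using dec n(1) unfolding clear_decomposition_def by blast
      moreover have "path_image (subpath (\<tau> n) (\<tau> (Suc n)) \<pi>) = \<pi> ` {\<tau> n..\<tau> (Suc n)}"
        using B(2) by (simp add: path_image_subpath)
      ultimately have "\<pi> s \<in> B" "\<pi> t \<in> B" by blast+
      then have "\<beta> * dist (\<pi> s) (\<pi> t) \<le> infdist (\<pi> s) Q"
        using clear_disk_dist_le[OF B(1) \<beta>0] by blast
      \<comment> \<open>Here m > n \<ge> 0, so the maintained edge stems from an event and has the
        gap.\<close>
      also have "\<dots> < \<beta> * (\<pi> s \<bullet> u - support_value Q u)"
        using event.IH mn by (simp add: e)
      \<comment> \<open>At time \<open>t\<close> the point is on the line of the edge chosen at time
        \<open>s\<close>, so the whole gap has been traversed.\<close>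
      also have "\<pi> s \<bullet> u - support_value Q u = (\<pi> s - \<pi> t) \<bullet> u"
        using line support_value_envelope[OF Q u] by (simp add: support_line_def inner_diff_left)
      also have "\<beta> * \<dots> \<le> \<beta> * dist (\<pi> s) (\<pi> t)"
        using norm_cauchy_schwarz[of "\<pi> s - \<pi> t" u] norm_envelope_normals[OF u] \<beta>0
        by (intro mult_left_mono) (auto simp: dist_norm)
      finally show False by simp
    qed
    then show ?case using st gap by (simp add: e')
  qed
  \<comment> \<open>Event times are at most 1 = \<open>\<tau> k\<close>, so the invariant for the
    last segment k - 1 bounds all events.\<close>
  moreover have "k \<noteq> 0" using \<tau> by (cases k) auto
  ultimately show ?thesis using \<tau> by (cases k) auto
qed

text \<open>Ensures that the \<open>LEAST\<close> in \<open>min_clear_size\<close> is attained. By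
  uniform continuity, sufficiently short equal pieces stay within d/\<kappa> of their starting
  points, and disks of that radius are clear.\<close>

lemma clear_decomposition_exists:
  assumes "path \<pi>" "0 < \<kappa>" "0 < d" and far: "\<And>t. 0 \<le> t \<Longrightarrow> t \<le> 1 \<Longrightarrow> d \<le> infdist (\<pi> t) Q"
  shows "\<exists>k \<tau>. clear_decomposition \<kappa> Q \<pi> k \<tau>"
proof -
  have "uniformly_continuous_on {0..1} \<pi>"
    using assms(1) by (intro compact_uniformly_continuous) (auto simp: path_def)
  then obtain \<delta> where \<delta>: "0 < \<delta>"
    "\<And>s t. s \<in> {0..1} \<Longrightarrow> t \<in> {0..1} \<Longrightarrow> dist t s < \<delta> \<Longrightarrow> dist (\<pi> t) (\<pi> s) < d / \<kappa>"
    using assms(2,3) unfolding uniformly_continuous_on_def by (metis divide_pos_pos)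
  obtain k where k: "0 < k" "1 / real k < \<delta>"
    using \<delta>(1) real_arch_inverse[of \<delta>] by (auto simp: inverse_eq_divide)
  define \<tau> where "\<tau> i = real i / real k" for i
  have "clear_disk \<kappa> Q (cball (\<pi> (\<tau> i)) (d / \<kappa>)) \<and> \<tau> i < \<tau> (Suc i) \<and>
      path_image (subpath (\<tau> i) (\<tau> (Suc i)) \<pi>) \<subseteq> cball (\<pi> (\<tau> i)) (d / \<kappa>)" if i: "i < k" for i
  proof (intro conjI)
    have \<tau>i: "0 \<le> \<tau> i" "\<tau> (Suc i) \<le> 1" using i by (simp_all add: \<tau>_def)
    show lt: "\<tau> i < \<tau> (Suc i)" using k by (simp add: \<tau>_def divide_strict_right_mono)
    have "d / \<kappa> \<le> infdist (\<pi> (\<tau> i)) Q / \<kappa>"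
      using far[of "\<tau> i"] \<tau>i lt assms(2) by (intro divide_right_mono) auto
    then show "clear_disk \<kappa> Q (cball (\<pi> (\<tau> i)) (d / \<kappa>))"
      unfolding clear_disk_def using assms(2,3) by (intro exI[of _ "\<pi> (\<tau> i)"] exI[of _ "d / \<kappa>"]) auto
    have "\<pi> t \<in> cball (\<pi> (\<tau> i)) (d / \<kappa>)" if t: "t \<in> {\<tau> i..\<tau> (Suc i)}" for t
    proof -
      have "\<tau> (Suc i) - \<tau> i = 1 / real k" by (simp add: \<tau>_def diff_divide_distrib[symmetric])
      then have "dist t (\<tau> i) < \<delta>" using t k(2) by (simp add: dist_real_def)
      then show ?thesis using \<delta>(2)[of "\<tau> i" t] t \<tau>i lt by (auto simp: dist_commute)
    qed
    then show "path_image (subpath (\<tau> i) (\<tau> (Suc i)) \<pi>) \<subseteq> cball (\<pi> (\<tau> i)) (d / \<kappa>)"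
      using lt by (subst path_image_subpath) auto
  qed
  moreover have "\<tau> 0 = 0" "\<tau> k = 1" using k by (simp_all add: \<tau>_def)
  ultimately show ?thesis unfolding clear_decomposition_def by blast
qed

theorem theorem6p2:
  fixes \<alpha> \<beta> \<kappa> :: real
  assumes "compass_height_constant \<alpha>"
    and "\<beta> = 2 * (1 + sqrt 2)"
    and "\<kappa> = 2 * \<beta> + 1"
  shows "\<kappa> = 5 + 4 * sqrt 2 \<and>
    (\<exists>c>0. \<forall>(Q :: complex set) (\<pi> :: real \<Rightarrow> complex) m t e.
       convex_polygon Q \<longrightarrow>
       path \<pi> \<longrightarrow>
       setdist (path_image \<pi>) Q \<ge> c * diameter Q / real (num_edges Q) \<longrightarrow>
       kds_run \<alpha> Q \<pi> m t e \<longrightarrow>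
       m \<le> min_clear_size \<kappa> Q \<pi>)"
proof
  show "\<kappa> = 5 + 4 * sqrt 2" using assms(2,3) by simp
  then have \<kappa>: "0 < \<kappa>" by (simp add: add_pos_pos)
  have \<alpha>: "0 < \<alpha>" using half_le_compass_height_constant[OF assms(1)] by simp
  \<comment> \<open>The first summand is the clearance demanded by
    \<open>replacement_edge_gap\<close>; adding 1 makes the inequality strict.\<close>
  define c where "c = (1 + sqrt 2) * \<alpha> + 1"
  have c: "0 < c" using \<alpha> by (simp add: c_def add_pos_pos)
  have "m \<le> min_clear_size \<kappa> Q \<pi>"
    if Q: "convex_polygon Q" and \<pi>: "path \<pi>"
      and far: "setdist (path_image \<pi>) Q \<ge> c * diameter Q / real (num_edges Q)"
      and run: "kds_run \<alpha> Q \<pi> m t e" for Q \<pi> m t e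
  proof -
    let ?d = "diameter Q / real (num_edges Q)"
    have d: "0 < ?d" using diameter_pos[OF Q] num_edges_pos[OF Q] by simp
    have dist: "c * ?d \<le> infdist (\<pi> t) Q" if "0 \<le> t" "t \<le> 1" for t
    proof -
      have "setdist (path_image \<pi>) Q \<le> setdist {\<pi> t} Q"
        using that by (intro setdist_subset_left) (auto simp: path_image_def)
      then show ?thesis using far by (simp add: infdist_eq_setdist)
    qed
    have "0 < c * ?d" using c d by (rule mult_pos_pos)
    then have "\<exists>k \<tau>. clear_decomposition \<kappa> Q \<pi> k \<tau>"
      using clear_decomposition_exists[OF \<pi> \<kappa>] dist by blast
    then have "\<exists>\<tau>. clear_decomposition \<kappa> Q \<pi> (min_clear_size \<kappa> Q \<pi>) \<tau>"
      unfolding min_clear_size_def by (rule LeastI_ex)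
    then obtain \<tau> where "clear_decomposition (2 * \<beta> + 1) Q \<pi> (min_clear_size \<kappa> Q \<pi>) \<tau>"
      unfolding assms(3) by blast
    moreover have "(1 + sqrt 2) * (\<alpha> * diameter Q / real (num_edges Q)) < infdist (\<pi> t) Q"
      if "0 \<le> t" "t \<le> 1" for t
    proof -
      have "c * ?d = (1 + sqrt 2) * (\<alpha> * ?d) + ?d" by (simp only: c_def distrib_right mult.assoc mult_1)
      then have "(1 + sqrt 2) * (\<alpha> * ?d) < c * ?d" using d by linarith
      then show ?thesis using dist[OF that] by simp
    qed
    ultimately show ?thesis
      using kds_run_le_clear_decomposition[OF assms(1) Q assms(2) _ _ run] by blast
  qed
  then show "\<exists>c>0. \<forall>(Q :: complex set) (\<pi> :: real \<Rightarrow> complex) m t e.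
       convex_polygon Q \<longrightarrow>
       path \<pi> \<longrightarrow>
       setdist (path_image \<pi>) Q \<ge> c * diameter Q / real (num_edges Q) \<longrightarrow>
       kds_run \<alpha> Q \<pi> m t e \<longrightarrow>
       m \<le> min_clear_size \<kappa> Q \<pi>"
    using c by blast
qed

end
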